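(* Let $0<x<1$ be real. The inverted graded parafermionic partition function of order $6$ satisfies $$\frac{1}{\Delta_6(x)}=\prod_{k=1}^{\infty}\frac{1+x^k}{1-x^{6k}}=\prod_{k=1}^{\infty}\frac{(1+x^{3k-1})(1+x^{3k-2})}{1-x^{3k}}.$$ Consequently $\frac{1}{\Delta_6(x)}=\sum_{n\ge0}a(n)x^n$, where $a(n)$ is the number of partitions of $n$ in which the parts not divisible by $3$ are distinct (each such part occurs at most once), while the parts divisible by $3$ may occur with arbitrary multiplicity.
   Context: The graded parafermionic partition function of order $s$ is $\Delta_s(x)=\prod_{k\ge1}\sum_{i=0}^{s-1}(-1)^i x^{ik}$. In the physical setting $x=e^{-\beta\omega}$ with $\beta,\omega>0$. The empty partition is the unique partition of $0$. *)

theory Defs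
  imports "HOL-Analysis.Analysis" "HOL-Library.Multiset"
begin

text \<open>Infinite products over $k \ge 1$ are written as products over all natural numbers $k$ in
  terms of \<open>Suc k\<close>.\<close>

definition graded_factor :: "nat \<Rightarrow> real \<Rightarrow> nat \<Rightarrow> real" where
  "graded_factor s x k = (\<Sum>i<s. (-1) ^ i * x ^ (i * k))"

definition graded_partition_function :: "nat \<Rightarrow> real \<Rightarrow> real" (\<open>\<Delta>\<close>) where
  "\<Delta> s x = (\<Prod>k. graded_factor s x (Suc k))"

definition partitions :: "nat \<Rightarrow> nat multiset set" where
  "partitions n = {P. 0 \<notin># P \<and> sum_mset P = n}"

definition restricted_partitions :: "nat \<Rightarrow> nat multiset set" where
  "restricted_partitions n = {P \<in> partitions n. \<forall>p \<in># P. \<not> 3 dvd p \<longrightarrow> count P p \<le> 1}"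

text \<open>Since \<open>card\<close> is 0 on infinite sets, counting partitions needs the following.\<close>

lemma finite_partitions: "finite (partitions n)"
proof (rule finite_subset)
  have size_le: "size P \<le> sum_mset P" if "0 \<notin># P" for P :: "nat multiset"
    using that by (induction P) (auto simp: Suc_le_eq)
  show "partitions n \<subseteq> mset ` {xs. set xs \<subseteq> {..n} \<and> length xs \<le> n}"
  proof
    fix P assume P: "P \<in> partitions n"
    obtain xs where xs: "mset xs = P" using ex_mset by blast
    have "p \<le> n" if "p \<in># P" for p
      using P that unfolding partitions_def by (auto dest: multi_member_split)
    moreover have "size P \<le> n"
      using P size_le unfolding partitions_def by auto
    ultimately show "P \<in> mset ` {xs. set xs \<subseteq> {..n} \<and> length xs \<le> n}"
      using xs by (intro image_eqI[of _ _ xs]) auto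
  qed
  show "finite (mset ` {xs. set xs \<subseteq> {..n} \<and> length xs \<le> n})"
    by (intro finite_imageI finite_lists_length_le) simp
qed

end

theory Submission
  imports Defs
begin

text \<open>Summing the geometric series in $-x^k$ turns the $k$-th factor of $\Delta_6$ into
  $(1 - x^{6k})/(1 + x^k)$. Grouping the factors $1 + x^k$ in threes and cancelling
  $1 + x^{3k}$ against $1 - x^{6k} = (1 - x^{3k})(1 + x^{3k})$ yields the second product. Its
  $n$-th partial product is the generating function of the restricted partitions with all parts at
  most $3n$; as all terms are nonnegative, letting $n$ tend to infinity exhausts the restricted
  partitions.\<close>

text \<open>The partial products of the grouped sequence form a subsequence of those of
  \<open>f\<close>, so they have the same limit. Since no factor vanishes, \<open>P\<close> is
  nonzero, as \<open>raw_has_prod\<close> demands of a limit.\<close>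

lemma has_prod_group:
  fixes f :: "nat \<Rightarrow> 'a::{semidom,t2_space}"
  assumes "f has_prod P" and nz: "\<And>k. f k \<noteq> 0" and "0 < m"
  shows "(\<lambda>k. \<Prod>i<m. f (k * m + i)) has_prod P"
proof -
  have "P \<noteq> 0"
    using has_prod_eq_0_iff[OF assms(1)] nz by fastforce
  have "(\<lambda>n. \<Prod>k<n. f k) \<longlonglongrightarrow> P"
    by (rule has_prod_imp_tendsto') fact
  \<comment> \<open>The subsequence starts at \<open>Suc n\<close> because
    \<open>raw_has_prod\<close> multiplies over all indices up to and including
    \<open>n\<close>.\<close>
  moreover have "strict_mono (\<lambda>n. Suc n * m)"
    using \<open>0 < m\<close> by (auto simp: strict_mono_def)
  ultimately have "(\<lambda>n. \<Prod>k<Suc n * m. f k) \<longlonglongrightarrow> P"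
    by (rule LIMSEQ_subseq_LIMSEQ [unfolded o_def])
  moreover have "(\<Prod>k\<le>n. \<Prod>i<m. f (k * m + i)) = (\<Prod>k<Suc n * m. f k)" for n
  proof -
    have "(\<Prod>i<m. f (k * m + i)) = prod f {k * m..<k * m + m}" for k
      using prod.atLeastLessThan_shift_0[of f "k * m" "k * m + m"] by (simp add: lessThan_atLeast0)
    then show ?thesis
      by (simp add: prod.nat_group lessThan_Suc_atMost [symmetric] del: mult_Suc)
  qed
  ultimately have "raw_has_prod (\<lambda>k. \<Prod>i<m. f (k * m + i)) 0 P"
    using \<open>P \<noteq> 0\<close> by (simp add: raw_has_prod_def del: mult_Suc)
  then show ?thesis
    by (simp add: has_prod_def)
qed

text \<open>Monotone convergence along an exhaustion. A finite subset of the union already lies in a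
  single \<open>A N\<close>, so \<open>L\<close> bounds every finite sum; conversely the total over
  the union bounds every \<open>S n\<close>, hence also \<open>L\<close>.\<close>

lemma has_sum_incseq_UN:
  fixes f :: "'a \<Rightarrow> real"
  assumes sums: "\<And>n. (f has_sum S n) (A n)" and "incseq A" and lim: "S \<longlonglongrightarrow> L"
    and nonneg: "\<And>a. a \<in> (\<Union>n. A n) \<Longrightarrow> 0 \<le> f a"
  shows "(f has_sum L) (\<Union>n. A n)"
proof -
  have "incseq S"
  proof (rule incseq_SucI)
    show "S n \<le> S (Suc n)" for n
      using has_sum_mono2[OF sums sums, of n "Suc n"] incseq_SucD[OF \<open>incseq A\<close>] nonneg by blast
  qed
  have chain: "subset.chain UNIV (range A)"
    using \<open>incseq A\<close> nat_le_linear unfolding subset_chain_def incseq_def by blast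
  have upper: "sum f F \<le> L" if F: "finite F" "F \<subseteq> (\<Union>n. A n)" for F
  proof -
    obtain N where "F \<subseteq> A N"
      using finite_subset_Union_chain[OF F _ chain] by blast
    then have "sum f F \<le> S N"
      using finite_sum_le_has_sum[OF sums] F nonneg by blast
    also have "S N \<le> L"
      using incseq_le[OF \<open>incseq S\<close> lim] .
    finally show ?thesis .
  qed
  have "f summable_on (\<Union>n. A n)"
    using upper by (intro nonneg_bdd_above_summable_on nonneg bdd_aboveI2 [of _ _ L]) auto
  then obtain T where T: "(f has_sum T) (\<Union>n. A n)"
    by (auto simp: summable_on_def)
  have "T \<le> L"
    using has_sum_le_finite_sums[OF T upper] .
  moreover have "S n \<le> T" for n
    using has_sum_mono2[OF sums T] nonneg by blast
  then have "L \<le> T"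
    using lim by (intro LIMSEQ_le_const2) auto
  ultimately show ?thesis
    using T by simp
qed

text \<open>Expanding a product of series amounts to choosing one multiplicity for each element of
  \<open>A\<close>, and such a choice is a multiset. \<open>K p\<close> holds the multiplicities
  allowed for \<open>p\<close>, and \<open>g p\<close> is the series of \<open>p\<close>
  alone.\<close>

lemma has_sum_prod_multisets:
  fixes f :: "'a \<Rightarrow> nat \<Rightarrow> real"
  assumes "finite A"
    and "\<And>p. p \<in> A \<Longrightarrow> (f p has_sum g p) (K p)"
    and "\<And>p j. p \<in> A \<Longrightarrow> j \<in> K p \<Longrightarrow> 0 \<le> f p j"
  shows "((\<lambda>P. \<Prod>p\<in>A. f p (count P p)) has_sum (\<Prod>p\<in>A. g p))
    {P. set_mset P \<subseteq> A \<and> (\<forall>p\<in>A. count P p \<in> K p)}"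
  using assms
proof (induction A rule: finite_induct)
  case empty
  have "{P. set_mset P \<subseteq> {}} = {{#} :: 'a multiset}"
    by auto
  then show ?case
    using has_sum_finite[of "{{#} :: 'a multiset}" "\<lambda>_. 1 :: real"] by simp
next
  case (insert q A)
  let ?M = "\<lambda>A. {P. set_mset P \<subseteq> A \<and> (\<forall>p\<in>A. count P p \<in> K p)}"
  let ?h = "\<lambda>(j, P). f q j * (\<Prod>p\<in>A. f p (count P p))"
  have IH: "((\<lambda>P. \<Prod>p\<in>A. f p (count P p)) has_sum (\<Prod>p\<in>A. g p)) (?M A)"
    using insert by auto
  have rows: "((\<lambda>P. ?h (j, P)) has_sum f q j * (\<Prod>p\<in>A. g p)) (?M A)" for j
    using has_sum_cmult_right[OF IH] by simp
  have column: "((\<lambda>j. f q j * (\<Prod>p\<in>A. g p)) has_sum g q * (\<Prod>p\<in>A. g p)) (K q)"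
    using insert.prems(1)[of q] by (intro has_sum_cmult_left) auto
  \<comment> \<open>For nonnegative terms, convergence of the iterated sum suffices for summability
    on the product set.\<close>
  have "?h summable_on K q \<times> ?M A"
  proof (rule summable_on_SigmaI[OF rows])
    show "(\<lambda>j. f q j * (\<Prod>p\<in>A. g p)) summable_on K q"
      using column by (auto simp: summable_on_def)
    show "0 \<le> ?h (j, P)" if "j \<in> K q" "P \<in> ?M A" for j P
      using that insert.prems(2) by (auto intro!: mult_nonneg_nonneg prod_nonneg)
  qed
  then have "(?h has_sum g q * (\<Prod>p\<in>A. g p)) (K q \<times> ?M A)"
    by (rule has_sum_SigmaI[OF rows column])
  also have "?this \<longleftrightarrow> ((\<lambda>P. \<Prod>p\<in>insert q A. f p (count P p)) has_sum
      (\<Prod>p\<in>insert q A. g p)) (?M (insert q A))"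
  \<comment> \<open>A multiset over \<open>insert q A\<close> splits uniquely into the multiplicity
    of \<open>q\<close> and a multiset over \<open>A\<close>.\<close>
  proof (rule has_sum_reindex_bij_witness[where
        j = "\<lambda>(j, P). P + replicate_mset j q" and
        i = "\<lambda>P. (count P q, filter_mset (\<lambda>p. p \<noteq> q) P)"])
    fix a assume "a \<in> K q \<times> ?M A"
    then obtain j P where a: "a = (j, P)" "j \<in> K q" "P \<in> ?M A"
      by blast
    have "q \<notin># P"
      using a insert.hyps by auto
    then have [simp]: "count P q = 0"
      by (simp add: count_eq_zero_iff)
    have other: "count P p + count (replicate_mset j q) p = count P p" if "p \<in> A" for p
      using that insert.hyps by auto
    show "(\<lambda>P. (count P q, filter_mset (\<lambda>p. p \<noteq> q) P)) ((\<lambda>(j, P). P + replicate_mset j q) a) = a"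
      by (auto simp: a intro!: multiset_eqI)
    show "(\<lambda>(j, P). P + replicate_mset j q) a \<in> ?M (insert q A)"
      using a other by (auto split: if_splits)
    show "(\<Prod>p\<in>insert q A. f p (count ((\<lambda>(j, P). P + replicate_mset j q) a) p)) = ?h a"
      using insert.hyps by (auto simp: a intro!: prod.cong)
  next
    fix P assume P: "P \<in> ?M (insert q A)"
    show "(\<lambda>(j, P). P + replicate_mset j q) (count P q, filter_mset (\<lambda>p. p \<noteq> q) P) = P"
      by (auto intro!: multiset_eqI)
    show "(count P q, filter_mset (\<lambda>p. p \<noteq> q) P) \<in> K q \<times> ?M A"
      using P insert.hyps by auto
  qed (use insert.hyps in simp)
  finally show ?case .
qed

text \<open>Absent parts contribute the factor \<open>x ^ 0\<close>, so the product may run over one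
  fixed finite set for all multisets supported in it.\<close>

lemma power_sum_mset:
  fixes x :: "'a::comm_semiring_1"
  assumes "finite A" "set_mset P \<subseteq> A"
  shows "x ^ sum_mset P = (\<Prod>p\<in>A. x ^ (p * count P p))"
proof -
  have "x ^ sum_mset P = (\<Prod>p\<in>#P. x ^ p)"
    by (induction P) (auto simp: power_add)
  also have "\<dots> = (\<Prod>p\<in>set_mset P. x ^ (p * count P p))"
    by (simp add: image_prod_mset_multiplicity power_mult)
  also have "\<dots> = (\<Prod>p\<in>A. x ^ (p * count P p))"
    using assms by (intro prod.mono_neutral_left) (auto simp: not_in_iff)
  finally show ?thesis .
qed

text \<open>Finite geometric series with ratio \<open>- (x ^ k)\<close>: evenness of
  \<open>s\<close> removes the sign from its \<open>s\<close>-th power, and \<open>0 \<le> x\<close>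
  keeps the denominator positive.\<close>

lemma graded_factor_even:
  assumes "even s" "0 \<le> x"
  shows "graded_factor s x k = (1 - x ^ (s * k)) / (1 + x ^ k)"
proof -
  have pos: "0 < 1 + x ^ k"
    using assms by (simp add: add_pos_nonneg)
  have "graded_factor s x k = (\<Sum>i<s. (- (x ^ k)) ^ i)"
    unfolding graded_factor_def
    by (intro sum.cong) (auto simp: power_minus [of "x ^ k"] power_mult [symmetric] mult.commute)
  moreover have "1 - (- (x ^ k)) ^ s = (1 + x ^ k) * (\<Sum>i<s. (- (x ^ k)) ^ i)"
    using one_diff_power_eq[of "- (x ^ k)" s] by simp
  ultimately show ?thesis
    using pos assms(1) by (simp add: field_simps power_mult [symmetric])
qed

lemma restricted_partition_partial_product:
  fixes x :: real
  assumes "0 < x" "x < 1"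
  shows "((\<lambda>P. x ^ sum_mset P) has_sum
      (\<Prod>k<n. (1 + x ^ (3 * Suc k - 1)) * (1 + x ^ (3 * Suc k - 2)) / (1 - x ^ (3 * Suc k))))
    {P. set_mset P \<subseteq> {1..3 * n} \<and> (\<forall>p\<in>#P. \<not> 3 dvd p \<longrightarrow> count P p \<le> 1)}"
proof -
  \<comment> \<open>A multiple of 3 may be repeated freely and contributes a full geometric series;
    any other part occurs at most once and contributes two terms.\<close>
  define K :: "nat \<Rightarrow> nat set" where "K p = (if 3 dvd p then UNIV else {0, 1})" for p
  define g where "g p = (if 3 dvd p then 1 / (1 - x ^ p) else 1 + x ^ p)" for p
  have "((\<lambda>j. x ^ (p * j)) has_sum g p) (K p)" if "p \<in> {1..3 * n}" for p
  proof (cases "3 dvd p")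
    case True
    have "x ^ p < 1"
      using assms that by (intro power_Suc_less_one [of x "p - 1", simplified]
          iffD2[OF power_less_one_iff]) auto
    then have "(\<lambda>j. (x ^ p) ^ j) sums (1 / (1 - x ^ p))"
      using assms by (intro geometric_sums) auto
    then have "((\<lambda>j. (x ^ p) ^ j) has_sum (1 / (1 - x ^ p))) UNIV"
      using assms by (intro sums_nonneg_imp_has_sum) auto
    then show ?thesis
      using True by (simp add: K_def g_def power_mult)
  next
    case False
    then show ?thesis
      using has_sum_finite[of "{0, 1}" "\<lambda>j. x ^ (p * j)"] by (simp add: K_def g_def)
  qed
  then have "((\<lambda>P. \<Prod>p\<in>{1..3 * n}. x ^ (p * count P p)) has_sum (\<Prod>p\<in>{1..3 * n}. g p))
      {P. set_mset P \<subseteq> {1..3 * n} \<and> (\<forall>p\<in>{1..3 * n}. count P p \<in> K p)}"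
    using assms by (intro has_sum_prod_multisets) auto
  also have "{P. set_mset P \<subseteq> {1..3 * n} \<and> (\<forall>p\<in>{1..3 * n}. count P p \<in> K p)} =
      {P. set_mset P \<subseteq> {1..3 * n} \<and> (\<forall>p\<in>#P. \<not> 3 dvd p \<longrightarrow> count P p \<le> 1)}"
  proof -
    have "(\<forall>p\<in>{1..3 * n}. count P p \<in> K p) \<longleftrightarrow> (\<forall>p\<in>#P. \<not> 3 dvd p \<longrightarrow> count P p \<le> 1)"
      if "set_mset P \<subseteq> {1..3 * n}" for P
    proof -
      \<comment> \<open>Multiplicity 0 belongs to every \<open>K p\<close>, so only parts that occur
        impose a condition.\<close>
      have "count P p \<in> K p \<longleftrightarrow> (p \<in># P \<longrightarrow> \<not> 3 dvd p \<longrightarrow> count P p \<le> 1)" for p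
        by (auto simp: K_def le_Suc_eq count_eq_zero_iff)
      then show ?thesis
        using that by blast
    qed
    then show ?thesis
      by blast
  qed
  also have "(\<Prod>p\<in>{1..3 * n}. g p) =
      (\<Prod>k<n. (1 + x ^ (3 * Suc k - 1)) * (1 + x ^ (3 * Suc k - 2)) / (1 - x ^ (3 * Suc k)))"
  \<comment> \<open>Each step admits the three new parts \<open>3 * n + 1\<close>,
    \<open>3 * n + 2\<close> and \<open>3 * n + 3\<close>, which together make up one factor on the
    right.\<close>
  proof (induction n)
    case (Suc n)
    have "{1..3 * Suc n} = {3 * n + 1, 3 * n + 2, 3 * n + 3} \<union> {1..3 * n}"
      by auto
    then have "(\<Prod>p\<in>{1..3 * Suc n}. g p) =
        g (3 * n + 1) * g (3 * n + 2) * g (3 * n + 3) * (\<Prod>p\<in>{1..3 * n}. g p)"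
      by (simp add: mult.assoc)
    moreover have "\<not> 3 dvd 3 * n + 1" "\<not> 3 dvd 3 * n + 2" "3 dvd 3 * n + 3"
      by presburger+
    ultimately show ?case
      using Suc.IH by (simp add: g_def numeral_eq_Suc)
  qed simp
  finally show ?thesis
    by (rule has_sum_cong[THEN iffD1, rotated])
      (use power_sum_mset[of "{1..3 * n}" _ x] in auto)
qed

theorem mainTheorem3:
  fixes x :: real
  assumes "0 < x" and "x < 1"
  shows "convergent_prod (\<lambda>k. graded_factor 6 x (Suc k))
    \<and> (\<lambda>k. (1 + x ^ Suc k) / (1 - x ^ (6 * Suc k))) has_prod (1 / \<Delta> 6 x)
    \<and> (\<lambda>k. (1 + x ^ (3 * Suc k - 1)) * (1 + x ^ (3 * Suc k - 2)) / (1 - x ^ (3 * Suc k)))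
        has_prod (1 / \<Delta> 6 x)
    \<and> (\<lambda>n. real (card (restricted_partitions n)) * x ^ n) sums (1 / \<Delta> 6 x)"
proof -
  let ?f = "\<lambda>k. (1 + x ^ (3 * Suc k - 1)) * (1 + x ^ (3 * Suc k - 2)) / (1 - x ^ (3 * Suc k))"
  have pow_less: "x ^ k < 1" if "0 < k" for k
    using assms that by (simp add: power_less_one_iff)
  have pow_pos: "0 < 1 + x ^ k" for k
    using assms by (simp add: add_pos_pos)
  \<comment> \<open>Used with \<open>m = 1\<close> and \<open>m = 6\<close>: absolute summability of
    the deviations from 1 makes the numerator and denominator products converge.\<close>
  have summable: "summable (\<lambda>k. x ^ (m * Suc k))" if "0 < m" for m
  proof -
    have "summable (\<lambda>k. (x ^ m) ^ Suc k)"
      using pow_less[OF that] assms by (subst summable_Suc_iff) (auto intro: summable_geometric)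
    then show ?thesis
      by (simp only: power_mult)
  qed
  have "convergent_prod (\<lambda>k. 1 + x ^ Suc k)"
    using summable[of 1] assms
    by (intro abs_convergent_prod_imp_convergent_prod summable_imp_abs_convergent_prod) simp
  then obtain a where a: "(\<lambda>k. 1 + x ^ Suc k) has_prod a"
    using convergent_prod_has_prod by blast
  have "convergent_prod (\<lambda>k. 1 - x ^ (6 * Suc k))"
    using summable[of 6] assms
    by (intro abs_convergent_prod_imp_convergent_prod summable_imp_abs_convergent_prod)
      (simp del: mult_Suc_right)
  then obtain b where b: "(\<lambda>k. 1 - x ^ (6 * Suc k)) has_prod b"
    using convergent_prod_has_prod by blast

  have \<Delta>: "(\<lambda>k. graded_factor 6 x (Suc k)) has_prod (b / a)"
    using has_prod_divide[OF b a] assms by (simp add: graded_factor_even)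
  then have \<Delta>_eq: "1 / \<Delta> 6 x = a / b"
    by (simp add: graded_partition_function_def flip: has_prod_unique[OF \<Delta>])

  \<comment> \<open>Only the numerators are grouped; each block of three is paired with a single
    denominator, and the value stays \<open>a / b\<close>.\<close>
  have "(\<lambda>k. (\<Prod>i<3. 1 + x ^ Suc (k * 3 + i)) / (1 - x ^ (6 * Suc k))) has_prod (a / b)"
    using pow_pos by (intro has_prod_divide has_prod_group a b)
      (auto simp: less_imp_neq [THEN not_sym] simp del: power_Suc)
  moreover have "(\<Prod>i<3. 1 + x ^ Suc (k * 3 + i)) / (1 - x ^ (6 * Suc k)) = ?f k" for k
  proof -
    \<comment> \<open>The last factor of the block is \<open>1 + y\<close>, and the denominator is
      \<open>1 - y ^ 2\<close>.\<close>
    define y where "y = x ^ (3 * Suc k)"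
    have exponents: "3 * Suc k - 1 = Suc (Suc (k * 3))" "3 * Suc k - 2 = Suc (k * 3)"
      "3 * Suc k = Suc (Suc (Suc (k * 3)))"
      by simp_all
    have "{..<3} = {2, 1, 0 :: nat}"
      by auto
    then have "(\<Prod>i<3. 1 + x ^ Suc (k * 3 + i)) =
        (1 + x ^ (3 * Suc k - 1)) * (1 + x ^ (3 * Suc k - 2)) * (1 + y)"
      unfolding y_def exponents by (simp add: mult_ac del: power_Suc)
    moreover have "x ^ (6 * Suc k) = y ^ 2"
      unfolding y_def by (simp flip: power_mult)
    then have "1 - x ^ (6 * Suc k) = (1 - y) * (1 + y)"
      by (simp add: algebra_simps power2_eq_square)
    moreover have "1 + y \<noteq> 0"
      unfolding y_def using pow_pos[of "3 * Suc k"] by linarith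
    ultimately show ?thesis
      by (simp only: y_def [symmetric] mult_divide_mult_cancel_right simp_thms)
  qed
  ultimately have f: "?f has_prod (a / b)"
    by (simp only:)

  let ?A = "\<lambda>n. {P :: nat multiset. set_mset P \<subseteq> {1..3 * n} \<and>
      (\<forall>p\<in>#P. \<not> 3 dvd p \<longrightarrow> count P p \<le> 1)}"
  have "((\<lambda>P. x ^ sum_mset P) has_sum (a / b)) (\<Union>n. ?A n)"
  proof (rule has_sum_incseq_UN[OF restricted_partition_partial_product[OF assms]])
    show "incseq ?A"
      by (rule incseq_SucI) auto
    show "(\<lambda>n. \<Prod>k<n. ?f k) \<longlonglongrightarrow> a / b"
      by (rule has_prod_imp_tendsto'[OF f])
  qed (use assms in auto)
  also have "(\<Union>n. ?A n) = {P. 0 \<notin># P \<and> (\<forall>p\<in>#P. \<not> 3 dvd p \<longrightarrow> count P p \<le> 1)}"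
  proof -
    \<comment> \<open>An upper bound \<open>m\<close> of the finitely many parts serves as
      \<open>n\<close>, since \<open>m\<close> is at most \<open>3 * m\<close>.\<close>
    have "\<exists>n. set_mset P \<subseteq> {1..3 * n}" if "0 \<notin># P" for P :: "nat multiset"
    proof -
      obtain m where "\<forall>p\<in>#P. p \<le> m"
        using finite_nat_set_iff_bounded_le[of "set_mset P"] by auto
      then have "set_mset P \<subseteq> {1..3 * m}"
        using that by (force simp: Suc_le_eq intro: gr0I)
      then show ?thesis ..
    qed
    then show ?thesis
      by auto
  qed
  \<comment> \<open>Tagging each multiset with its sum sorts the terms into fibres over
    \<open>n\<close>. Each fibre is finite with constant term \<open>x ^ n\<close>, so summing it
    gives the coefficient \<open>card (restricted_partitions n)\<close>.\<close>
  also have "((\<lambda>P. x ^ sum_mset P) has_sum (a / b)) \<dots> \<longleftrightarrow>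
      ((\<lambda>(n, P). x ^ n) has_sum (a / b)) (Sigma UNIV restricted_partitions)"
    by (rule has_sum_reindex_bij_witness[where j = "\<lambda>P. (sum_mset P, P)" and i = snd])
      (auto simp: restricted_partitions_def partitions_def)
  finally have "((\<lambda>n. real (card (restricted_partitions n)) * x ^ n) has_sum (a / b)) UNIV"
  proof (rule has_sum_SigmaD)
    fix n
    have "finite (restricted_partitions n)"
      using finite_partitions by (rule finite_subset[rotated]) (auto simp: restricted_partitions_def)
    then show "((\<lambda>P. (\<lambda>(n, P). x ^ n) (n, P)) has_sum real (card (restricted_partitions n)) * x ^ n)
        (restricted_partitions n)"
      using has_sum_finite[of "restricted_partitions n" "\<lambda>_. x ^ n"] by simp
  qed
  then have "(\<lambda>n. real (card (restricted_partitions n)) * x ^ n) sums (a / b)"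
    by (rule has_sum_imp_sums)
  moreover have "convergent_prod (\<lambda>k. graded_factor 6 x (Suc k))"
    using \<Delta> by (simp only: has_prod_iff)
  ultimately show ?thesis
    unfolding \<Delta>_eq using has_prod_divide[OF a b] f by blast
qed

end
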